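(* Let $a,b\ge 0$ with $(a,b)\neq(0,0)$, and consider the normalized linear-linear loss function $$L(x)=\begin{cases} a(1-x) & \text{if } x\le 1,\\ b(x-1) & \text{if } x>1.\end{cases}$$ Let $r\ge 2$ be an integer. For $p\in(0,1)$ let $N$ be the number of trials in inverse binomial sampling with parameters $r$ and $p$, and let $\eta(p)=\mathrm{E}[L(\hat p/p)]$ be the risk of the estimator $\hat p=(r-1)/(N-1)$. Then $\lim_{p\to 0}\eta(p)$ exists and equals $$\lim_{p\to 0}\eta(p)=\frac{(a+b)(r-1)^{r-2}\exp(-r+1)}{(r-2)!},$$ and $$\eta(p)<\frac{(a+b)(r-1)^{r-2}\exp(-r+1)}{(r-2)!}\quad\text{for any } p\in(0,1).$$
   Context: Inverse binomial sampling: in a sequence of independent Bernoulli trials with success probability $p\in(0,1)$, observations are taken until exactly $r$ successes are obtained; $N$ is the (random) number of observations. Thus $N$ has the negative binomial distribution $P[N=n]=\binom{n-1}{r-1}p^r(1-p)^{n-r}$, $n\ge r$. For an estimator $\hat p=g(N)$ the risk is $\eta(p)=\mathrm{E}[L(\hat p/p)]=\sum_{n=r}^\infty P[N=n]\,L(g(n)/p)$. *)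

theory Defs
  imports "HOL-Probability.Probability"
begin

definition bernoulli_trials :: "real \<Rightarrow> bool stream measure" where
  "bernoulli_trials p = stream_space (measure_pmf (bernoulli_pmf p))"

(* Trials are indexed from 0, so n observations are the trials i < n.
   For 0 < p < 1 a number of trials with exactly r successes exists almost surely;
   on the remaining null set the value of LEAST is irrelevant. *)
definition num_observations :: "nat \<Rightarrow> bool stream \<Rightarrow> nat" where
  "num_observations r \<omega> = (LEAST n. card {i. i < n \<and> \<omega> !! i} = r)"

definition lin_lin_loss :: "real \<Rightarrow> real \<Rightarrow> real \<Rightarrow> real" where
  "lin_lin_loss a b x = (if x \<le> 1 then a * (1 - x) else b * (x - 1))"

(* The Bochner integral is the true expectation whenever the integrand is integrable,
   in particular whenever g and L are bounded on the ranges involved. *)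
definition risk :: "(real \<Rightarrow> real) \<Rightarrow> (nat \<Rightarrow> real) \<Rightarrow> nat \<Rightarrow> real \<Rightarrow> real" where
  "risk L g r p = (\<integral>\<omega>. L (g (num_observations r \<omega>) / p) \<partial>bernoulli_trials p)"

definition ibs_estimator :: "nat \<Rightarrow> nat \<Rightarrow> real" where
  "ibs_estimator r n = (real r - 1) / (real n - 1)"

end

theory Submission
  imports Defs "HOL-Real_Asymp.Real_Asymp"
begin

text \<open>The estimator is unbiased, so the risk is \<open>a + b\<close> times the expected positive part of the
  relative error. Multiplying the negative binomial weights with parameter \<open>r = s + 1\<close> by \<open>s / ((N - 1) p)\<close>
  gives those with parameter \<open>s\<close>; the resulting finite sum telescopes to the single term
  \<open>(K + s - 1 choose s) p\<^sup>s (1 - p)\<^sup>K\<close>, where \<open>K + s\<close> is \<open>s / p\<close> rounded up. For fixed \<open>K\<close> this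
  is largest at \<open>p = s / (K + s)\<close>, and there the elementary bound
  \<open>(m / (m + 1))\<^bsup>m+1\<^esup> < exp (-1)\<close>, iterated \<open>s\<close> times from \<open>m = K\<close>, keeps it below
  \<open>s\<^sup>s exp (-s) / s!\<close>, which is also its limit since \<open>K p\<close> tends to \<open>s\<close>.\<close>

section \<open>The number of observations\<close>

lemma successes_measurable [measurable]:
  "(\<lambda>\<omega>. card {i. i < n \<and> \<omega> !! i}) \<in> measurable (stream_space (measure_pmf M)) (count_space UNIV)"
proof (rule measurable_card)
  fix i
  have "Measurable.pred (stream_space (measure_pmf M)) (\<lambda>\<omega>. \<omega> !! i)"
    by (rule measurable_compose[OF measurable_snth]) simp
  then have "Measurable.pred (stream_space (measure_pmf M)) (\<lambda>\<omega>. i < n \<and> \<omega> !! i)"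
    by measurable
  then show "{\<omega> \<in> space (stream_space (measure_pmf M)). i \<in> {i. i < n \<and> \<omega> !! i}}
      \<in> sets (stream_space (measure_pmf M))"
    by simp
qed

text \<open>Trials are indexed from 0: this is the event that the success number \<open>s + 1\<close> occurs at
  index \<open>n\<close>, that is, \<open>N = n + 1\<close> for \<open>r = s + 1\<close>.\<close>

definition success_event :: "nat \<Rightarrow> nat \<Rightarrow> bool stream set" where
  "success_event s n = {\<omega>. card {i. i < n \<and> \<omega> !! i} = s \<and> \<omega> !! n}"

lemma space_bernoulli_trials [simp]: "space (bernoulli_trials p) = UNIV"
  by (simp add: bernoulli_trials_def space_stream_space)

lemma sets_success_event [measurable]: "success_event s n \<in> sets (bernoulli_trials p)"
proof -
  have "Measurable.pred (bernoulli_trials p) (\<lambda>\<omega>. \<omega> !! n)"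
    unfolding bernoulli_trials_def by (rule measurable_compose[OF measurable_snth]) simp
  moreover have "Measurable.pred (bernoulli_trials p) (\<lambda>\<omega>. card {i. i < n \<and> \<omega> !! i} = s)"
    unfolding bernoulli_trials_def by measurable
  ultimately have "Measurable.pred (bernoulli_trials p)
      (\<lambda>\<omega>. card {i. i < n \<and> \<omega> !! i} = s \<and> \<omega> !! n)"
    by measurable
  then show ?thesis
    by (simp add: success_event_def pred_def)
qed

lemma measurable_num_observations [measurable]:
  "num_observations r \<in> measurable (bernoulli_trials p) (count_space UNIV)"
  unfolding num_observations_def[abs_def] bernoulli_trials_def by measurable

lemma prob_space_bernoulli_trials: "prob_space (bernoulli_trials p)"
  unfolding bernoulli_trials_def by (rule prob_space.prob_space_stream_space[OF prob_space_measure_pmf])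

lemma card_successes_Cons:
  "card {i. i < Suc n \<and> (b ## \<omega>) !! i} = of_bool b + card {i. i < n \<and> \<omega> !! i}"
proof -
  have "{i. i < Suc n \<and> (b ## \<omega>) !! i} = (if b then {0} else {}) \<union> Suc ` {i. i < n \<and> \<omega> !! i}"
    (is "?A = ?B")
  proof (rule set_eqI)
    fix i show "i \<in> ?A \<longleftrightarrow> i \<in> ?B" by (cases i) auto
  qed
  then show ?thesis
    by (auto simp: card_image card_insert_if)
qed

text \<open>Conditioning on the first trial: a success lowers the number of successes still required
  by one. The guard \<open>s \<noteq> 0\<close> stops the truncated \<open>s - 1\<close> from
  admitting a spurious case.\<close>

lemma Cons_in_success_event:
  "b ## \<omega> \<in> success_event s (Suc n) \<longleftrightarrow>
     (if b then s \<noteq> 0 \<and> \<omega> \<in> success_event (s - 1) n else \<omega> \<in> success_event s n)"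
  by (auto simp: success_event_def card_successes_Cons)

lemma emeasure_bernoulli_trials:
  assumes "0 \<le> p" "p \<le> 1" and X: "X \<in> sets (bernoulli_trials p)"
  shows "emeasure (bernoulli_trials p) X =
    ennreal p * emeasure (bernoulli_trials p) {\<omega>. True ## \<omega> \<in> X} +
    ennreal (1 - p) * emeasure (bernoulli_trials p) {\<omega>. False ## \<omega> \<in> X}"
  using prob_space.emeasure_stream_space[OF prob_space_measure_pmf X[unfolded bernoulli_trials_def]] assms(1,2)
  by (simp add: bernoulli_trials_def space_stream_space nn_integral_bernoulli_pmf mult.commute)

text \<open>Induction over the first trial, with \<open>s\<close> varying, reduces the claim to
  Pascal's rule. For \<open>s > n\<close> the binomial coefficient is 0, so the truncated exponent
  \<open>n - s\<close> is harmless.\<close>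

lemma emeasure_success_event:
  assumes "0 \<le> p" "p \<le> 1"
  shows "emeasure (bernoulli_trials p) (success_event s n) =
    ennreal (real (n choose s) * p ^ Suc s * (1 - p) ^ (n - s))"
proof (induction n arbitrary: s)
  case 0
  interpret prob_space "bernoulli_trials p" by (rule prob_space_bernoulli_trials)
  have "{\<omega>. True ## \<omega> \<in> success_event s 0} = (if s = 0 then UNIV else {})"
    "{\<omega>. False ## \<omega> \<in> success_event s 0} = {}"
    by (auto simp: success_event_def)
  then show ?case
    using emeasure_space_1
    by (cases s) (simp_all add: emeasure_bernoulli_trials[OF assms sets_success_event])
next
  case (Suc n)
  have E: "emeasure (bernoulli_trials p) (success_event s (Suc n)) =
      ennreal p * emeasure (bernoulli_trials p) (if s = 0 then {} else success_event (s - 1) n) +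
      ennreal (1 - p) * emeasure (bernoulli_trials p) (success_event s n)"
    by (subst emeasure_bernoulli_trials) (auto simp: assms Cons_in_success_event)
  show ?case
  proof (cases s)
    case 0
    then show ?thesis
      using E assms by (simp add: Suc.IH ennreal_mult[symmetric] mult_ac)
  next
    case (Suc t)
    have "emeasure (bernoulli_trials p) (success_event s (Suc n)) =
      ennreal (p * (real (n choose t) * p ^ Suc t * (1 - p) ^ (n - t)) +
        (1 - p) * (real (n choose Suc t) * p ^ Suc (Suc t) * (1 - p) ^ (n - Suc t)))"
      using E assms Suc by (simp add: Suc.IH ennreal_mult[symmetric] ennreal_plus[symmetric] del: ennreal_plus)
    also have "p * (real (n choose t) * p ^ Suc t * (1 - p) ^ (n - t)) +
        (1 - p) * (real (n choose Suc t) * p ^ Suc (Suc t) * (1 - p) ^ (n - Suc t)) =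
        real (Suc n choose s) * p ^ Suc s * (1 - p) ^ (Suc n - s)"
    \<comment> \<open>For \<open>t \<ge> n\<close> the second binomial coefficient vanishes and both
      truncated exponents of the remaining terms are 0.\<close>
    proof (cases "t < n")
      case True
      then have "n - t = Suc (n - Suc t)" by simp
      then show ?thesis using Suc by (simp add: algebra_simps)
    qed (use Suc in \<open>auto simp: binomial_eq_0\<close>)
    finally show ?thesis .
  qed
qed

lemma num_observations_success_event:
  assumes "\<omega> \<in> success_event s n"
  shows "num_observations (Suc s) \<omega> = Suc n"
  unfolding num_observations_def
proof (rule Least_equality)
  have "{i. i < Suc n \<and> \<omega> !! i} = insert n {i. i < n \<and> \<omega> !! i}"
    using assms by (auto simp: success_event_def less_Suc_eq)
  then show "card {i. i < Suc n \<and> \<omega> !! i} = Suc s"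
    using assms by (simp add: success_event_def)
next
  fix m assume m: "card {i. i < m \<and> \<omega> !! i} = Suc s"
  show "Suc n \<le> m"
  proof (rule ccontr)
    assume "\<not> Suc n \<le> m"
    then have "card {i. i < m \<and> \<omega> !! i} \<le> card {i. i < n \<and> \<omega> !! i}"
      by (intro card_mono) auto
    then show False using m assms by (simp add: success_event_def)
  qed
qed

text \<open>\<open>neg_binomial_pmf\<close> counts failures: with \<open>k\<close> failures and
  \<open>s\<close> earlier successes, the final success has index \<open>k + s\<close>.\<close>

lemma emeasure_success_event_neg_binomial:
  assumes "0 < p" "p \<le> 1"
  shows "emeasure (bernoulli_trials p) (success_event s (k + s)) =
    ennreal (pmf (neg_binomial_pmf (Suc s) p) k)"
  using assms
  by (simp add: emeasure_success_event pmf_neg_binomial binomial_symmetric[of s "k + s"])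

text \<open>The events are disjoint, since each fixes the value of \<open>num_observations\<close>,
  and their probabilities sum to the total mass of a pmf, which is 1.\<close>

lemma AE_success_event:
  assumes "0 < p" "p \<le> 1"
  shows "AE \<omega> in bernoulli_trials p. \<exists>k. \<omega> \<in> success_event s (k + s)"
proof -
  interpret prob_space "bernoulli_trials p" by (rule prob_space_bernoulli_trials)
  have disj: "disjoint_family (\<lambda>k. success_event s (k + s))"
    unfolding disjoint_family_on_def
    by (metis disjoint_iff add_right_cancel nat.inject num_observations_success_event)
  have "emeasure (bernoulli_trials p) (\<Union>k. success_event s (k + s)) =
      (\<Sum>k. ennreal (pmf (neg_binomial_pmf (Suc s) p) k))"
    using assms by (subst suminf_emeasure[symmetric, OF _ disj])
      (auto simp: emeasure_success_event_neg_binomial)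
  also have "\<dots> = 1"
    by (simp add: nn_integral_count_space_nat[symmetric] nn_integral_pmf)
  finally have "AE \<omega> in bernoulli_trials p. \<omega> \<in> (\<Union>k. success_event s (k + s))"
    by (intro AE_prob_1) (simp add: emeasure_eq_measure)
  then show ?thesis by simp
qed

text \<open>Both measures live on the countable set of values at least \<open>Suc s\<close>, so it
  suffices to compare singletons.\<close>

lemma distr_num_observations:
  assumes "0 < p" "p \<le> 1"
  shows "distr (bernoulli_trials p) (count_space UNIV) (num_observations (Suc s)) =
    measure_pmf (map_pmf (\<lambda>k. Suc (k + s)) (neg_binomial_pmf (Suc s) p))"
proof (rule measure_eqI_countable_AE)
  show "AE n in distr (bernoulli_trials p) (count_space UNIV) (num_observations (Suc s)).
      n \<in> range (\<lambda>k. Suc (k + s))"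
    using AE_success_event[OF assms, of s]
    by (subst AE_distr_iff) (auto elim!: eventually_mono dest: num_observations_success_event)
  show "AE n in measure_pmf (map_pmf (\<lambda>k. Suc (k + s)) (neg_binomial_pmf (Suc s) p)).
      n \<in> range (\<lambda>k. Suc (k + s))"
    by (auto simp: AE_measure_pmf_iff)
next
  fix n assume "n \<in> range (\<lambda>k. Suc (k + s))"
  then obtain k where n: "n = Suc (k + s)" by auto
  have "emeasure (bernoulli_trials p) (num_observations (Suc s) -` {n}) =
      emeasure (bernoulli_trials p) (success_event s (k + s))"
  proof (rule emeasure_eq_AE)
    show "AE \<omega> in bernoulli_trials p.
        \<omega> \<in> num_observations (Suc s) -` {n} \<longleftrightarrow> \<omega> \<in> success_event s (k + s)"
      using AE_success_event[OF assms, of s]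
    proof eventually_elim
      case (elim \<omega>)
      then obtain j where j: "\<omega> \<in> success_event s (j + s)" by blast
      then have "num_observations (Suc s) \<omega> = Suc (j + s)"
        by (rule num_observations_success_event)
      with j show ?case
        using num_observations_success_event[of \<omega> s "k + s"] by (auto simp: n)
    qed
    show "num_observations (Suc s) -` {n} \<in> sets (bernoulli_trials p)"
      using measurable_sets[OF measurable_num_observations, of "{n}" "Suc s" p] by simp
  qed auto
  also have "\<dots> = ennreal (pmf (neg_binomial_pmf (Suc s) p) k)"
    by (rule emeasure_success_event_neg_binomial[OF assms])
  also have "\<dots> = ennreal (pmf (map_pmf (\<lambda>k. Suc (k + s)) (neg_binomial_pmf (Suc s) p)) n)"
    unfolding n by (subst pmf_map_inj'[of "\<lambda>k. Suc (k + s)"]) (auto intro: injI)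
  finally show "emeasure (distr (bernoulli_trials p) (count_space UNIV) (num_observations (Suc s))) {n} =
      emeasure (measure_pmf (map_pmf (\<lambda>k. Suc (k + s)) (neg_binomial_pmf (Suc s) p))) {n}"
    by (simp add: emeasure_distr emeasure_pmf_single)
qed auto

lemma risk_eq_neg_binomial_expectation:
  assumes "0 < p" "p \<le> 1"
  shows "risk L g (Suc s) p =
    measure_pmf.expectation (neg_binomial_pmf (Suc s) p) (\<lambda>k. L (g (Suc (k + s)) / p))"
proof -
  have "risk L g (Suc s) p =
      (\<integral>n. L (g n / p) \<partial>distr (bernoulli_trials p) (count_space UNIV) (num_observations (Suc s)))"
    unfolding risk_def by (subst integral_distr) auto
  then show ?thesis
    by (simp add: distr_num_observations[OF assms])
qed

section \<open>Closed form of the risk\<close>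

text \<open>This is the absorption identity
  \<open>s * (k + s choose s) = (k + s) * (k + s - 1 choose s - 1)\<close>.\<close>

lemma pmf_neg_binomial_Suc_div:
  assumes "0 < p" "p \<le> 1" "0 < s"
  shows "pmf (neg_binomial_pmf (Suc s) p) k * (real s / (real (k + s) * p)) =
    pmf (neg_binomial_pmf s p) k"
proof -
  have "real s * real ((k + s) choose s) = real (k + s) * real ((k + s - 1) choose (s - 1))"
    using times_binomial_minus1_eq[of s "k + s"] assms(3) by (metis of_nat_mult)
  moreover have "(k + s) choose s = (k + s) choose k" "(k + s - 1) choose (s - 1) = (k + s - 1) choose k"
    using binomial_symmetric[of s "k + s"] binomial_symmetric[of "s - 1" "k + s - 1"] assms(3) by auto
  ultimately have "real ((k + s) choose k) * real s = real (k + s) * real ((k + s - 1) choose k)"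
    by (simp add: mult.commute)
  moreover have "pmf (neg_binomial_pmf (Suc s) p) k * real s =
      (real ((k + s) choose k) * real s) * (p ^ Suc s * (1 - p) ^ k)"
    "pmf (neg_binomial_pmf s p) k * (real (k + s) * p) =
      (real (k + s) * real ((k + s - 1) choose k)) * (p ^ Suc s * (1 - p) ^ k)"
    using assms by (simp_all add: pmf_neg_binomial)
  ultimately have "pmf (neg_binomial_pmf (Suc s) p) k * real s =
      pmf (neg_binomial_pmf s p) k * (real (k + s) * p)"
    by (simp only:)
  moreover have "real (k + s) * p \<noteq> 0" using assms by simp
  ultimately show ?thesis
    by (metis eq_divide_eq times_divide_eq_right)
qed

text \<open>For \<open>K > 0\<close> this is the probability that the first \<open>K + s - 1\<close>
  trials contain exactly \<open>s\<close> successes and the next one fails.\<close>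

definition neg_binomial_gap :: "nat \<Rightarrow> real \<Rightarrow> nat \<Rightarrow> real" where
  "neg_binomial_gap s p K = real ((K + s - 1) choose s) * p ^ s * (1 - p) ^ K"

lemma sum_pmf_neg_binomial_diff:
  assumes "0 < p" "p \<le> 1" "0 < s"
  shows "(\<Sum>k<K. pmf (neg_binomial_pmf s p) k - pmf (neg_binomial_pmf (Suc s) p) k) =
    neg_binomial_gap s p K"
proof (induction K)
  case 0
  then show ?case using assms by (simp add: neg_binomial_gap_def binomial_eq_0)
next
  case (Suc K)
  obtain t where t: "s = Suc t" using assms(3) by (cases s) auto
  have "(K + s) choose K = (K + s) choose s" "(K + t) choose K = (K + t) choose t"
    using binomial_symmetric[of s "K + s"] binomial_symmetric[of t "K + t"] by auto
  then show ?case
    using assms Suc by (simp add: neg_binomial_gap_def pmf_neg_binomial t algebra_simps)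
qed

text \<open>The linear term has expectation 0 by unbiasedness, so only the positive part contributes
  to the risk.\<close>

lemma lin_lin_loss_eq: "lin_lin_loss a b x = (a + b) * max 0 (x - 1) + a * (1 - x)"
  by (auto simp: lin_lin_loss_def max_def algebra_simps)

text \<open>The number of failures from which on the estimate is at most \<open>p\<close>.\<close>

definition switch_index :: "nat \<Rightarrow> real \<Rightarrow> nat" where
  "switch_index s p = nat \<lceil>real s / p\<rceil> - s"

lemma less_switch_index_iff:
  assumes "0 < p"
  shows "k < switch_index s p \<longleftrightarrow> real (k + s) < real s / p"
proof -
  have "k < switch_index s p \<longleftrightarrow> int (k + s) < \<lceil>real s / p\<rceil>"
    unfolding switch_index_def by linarith
  also have "\<dots> \<longleftrightarrow> real (k + s) < real s / p"
    by (simp add: less_ceiling_iff)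
  finally show ?thesis .
qed

lemma risk_lin_lin_loss_ibs:
  assumes "0 < p" "p < 1" "0 < s"
  shows "risk (lin_lin_loss a b) (ibs_estimator (Suc s)) (Suc s) p =
    (a + b) * neg_binomial_gap s p (switch_index s p)"
proof -
  let ?M = "neg_binomial_pmf (Suc s) p" and ?K = "switch_index s p"
  define x where "x k = real s / (real (k + s) * p)" for k
  have p: "0 < p" "p \<le> 1" using assms by auto
  have x_bounds: "0 \<le> x k" "x k \<le> 1 / p" for k
  proof -
    show "0 \<le> x k" using assms by (simp add: x_def)
    have "x k = real s / real (k + s) * (1 / p)" by (simp add: x_def)
    also have "\<dots> \<le> 1 * (1 / p)" using assms by (intro mult_right_mono) auto
    finally show "x k \<le> 1 / p" by simp
  qed
  have x_le_1: "x k \<le> 1 \<longleftrightarrow> \<not> k < ?K" for k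
  proof -
    have "0 < real (k + s) * p" using assms by simp
    then have "x k \<le> 1 \<longleftrightarrow> real s \<le> real (k + s) * p"
      unfolding x_def by (subst divide_le_eq) auto
    also have "\<dots> \<longleftrightarrow> \<not> real (k + s) < real s / p"
      using assms by (subst less_divide_eq) auto
    finally show ?thesis using assms by (simp add: less_switch_index_iff)
  qed
  have int_x: "integrable (measure_pmf ?M) x"
    using x_bounds by (intro measure_pmf.integrable_const_bound[where B = "1 / p"]) auto
  have int_max: "integrable (measure_pmf ?M) (\<lambda>k. max 0 (x k - 1))"
    using int_x by auto
  \<comment> \<open>Unbiasedness: reweighting by \<open>x\<close> turns the pmf with parameter
    \<open>Suc s\<close> into the one with parameter \<open>s\<close>, of total mass 1.\<close>
  have "measure_pmf.expectation ?M x = (\<integral>k. pmf ?M k * x k \<partial>count_space UNIV)"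
    by (simp add: measure_pmf_eq_density integral_density)
  also have "\<dots> = (\<integral>k. pmf (neg_binomial_pmf s p) k \<partial>count_space UNIV)"
    unfolding x_def using pmf_neg_binomial_Suc_div[OF p assms(3)] by simp
  also have "\<dots> = 1"
    by (simp add: integral_pmf)
  finally have Ex: "measure_pmf.expectation ?M x = 1" .
  \<comment> \<open>The positive part vanishes from \<open>?K\<close> on, so its expectation is a
    finite sum.\<close>
  have "measure_pmf.expectation ?M (\<lambda>k. max 0 (x k - 1)) =
      (\<Sum>k<?K. pmf ?M k *\<^sub>R max 0 (x k - 1))"
  proof (rule integral_measure_pmf)
    fix k assume "max 0 (x k - 1) \<noteq> 0"
    then have "\<not> x k \<le> 1" by auto
    then show "k \<in> {..<?K}" using x_le_1[of k] by simp
  qed simp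
  also have "\<dots> = (\<Sum>k<?K. pmf (neg_binomial_pmf s p) k - pmf ?M k)"
  proof (rule sum.cong)
    fix k assume "k \<in> {..<?K}"
    then have "max 0 (x k - 1) = x k - 1" using x_le_1[of k] by (auto simp: max_def)
    then show "pmf ?M k *\<^sub>R max 0 (x k - 1) = pmf (neg_binomial_pmf s p) k - pmf ?M k"
      using pmf_neg_binomial_Suc_div[OF p assms(3), of k] by (simp add: x_def right_diff_distrib)
  qed simp
  also have "\<dots> = neg_binomial_gap s p ?K"
    by (rule sum_pmf_neg_binomial_diff[OF p assms(3)])
  finally have Emax: "measure_pmf.expectation ?M (\<lambda>k. max 0 (x k - 1)) = neg_binomial_gap s p ?K" .
  have "risk (lin_lin_loss a b) (ibs_estimator (Suc s)) (Suc s) p =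
      measure_pmf.expectation ?M (\<lambda>k. (a + b) * max 0 (x k - 1) + a * (1 - x k))"
    unfolding risk_eq_neg_binomial_expectation[OF p]
    by (simp add: lin_lin_loss_eq[symmetric] ibs_estimator_def x_def)
  also have "\<dots> = (a + b) * neg_binomial_gap s p ?K"
    using int_x int_max by (simp add: Emax Ex)
  finally show ?thesis .
qed

lemma binomial_pochhammer:
  "0 < K \<Longrightarrow> real ((K + s - 1) choose s) = pochhammer (real K) s / fact s"
  by (simp add: binomial_gbinomial gbinomial_pochhammer' of_nat_diff)

section \<open>The upper bound\<close>

text \<open>\<open>u\<close> and \<open>v\<close> are \<open>p\<close> and \<open>1 - p\<close>
  relative to their values at the maximiser \<open>s / (K + s)\<close>. Applying
  \<open>x \<le> exp (x - 1)\<close> to both gives exponents whose weighted sum is 0.\<close>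

lemma power_mult_power_le_max:
  fixes p :: real
  assumes "0 \<le> p" "p \<le> 1" "0 < s" "0 < K"
  shows "p ^ s * (1 - p) ^ K \<le> (real s / real (K + s)) ^ s * (real K / real (K + s)) ^ K"
proof -
  define u where "u = p * real (K + s) / real s"
  define v where "v = (1 - p) * real (K + s) / real K"
  have "0 \<le> u" "0 \<le> v" using assms by (auto simp: u_def v_def)
  have u: "u \<le> exp (u - 1)" and v: "v \<le> exp (v - 1)"
    using exp_ge_add_one_self[of "u - 1"] exp_ge_add_one_self[of "v - 1"] by auto
  have "u ^ s * v ^ K \<le> exp (u - 1) ^ s * exp (v - 1) ^ K"
    using u v \<open>0 \<le> u\<close> \<open>0 \<le> v\<close> by (intro mult_mono power_mono) auto
  also have "\<dots> = exp (real s * (u - 1) + real K * (v - 1))"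
    by (simp add: exp_add exp_of_nat_mult)
  also have "real s * (u - 1) + real K * (v - 1) = 0"
    using assms by (simp add: u_def v_def field_simps)
  finally have uv: "u ^ s * v ^ K \<le> 1" by simp
  have "p = u * (real s / real (K + s))" "1 - p = v * (real K / real (K + s))"
    using assms by (simp_all add: u_def v_def)
  then have "p ^ s * (1 - p) ^ K =
      (u ^ s * v ^ K) * ((real s / real (K + s)) ^ s * (real K / real (K + s)) ^ K)"
    by (metis power_mult_distrib mult.assoc mult.left_commute)
  also have "\<dots> \<le> 1 * ((real s / real (K + s)) ^ s * (real K / real (K + s)) ^ K)"
    using uv by (intro mult_right_mono) auto
  finally show ?thesis by simp
qed

lemma one_minus_inverse_power_less_exp:
  assumes "0 < m"
  shows "(real m / real (Suc m)) ^ Suc m < exp (-1)"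
proof -
  have "real m / real (Suc m) < exp (- 1 / real (Suc m))"
    using exp_minus_greater[of "1 / real (Suc m)"] by (simp add: field_simps)
  then have "(real m / real (Suc m)) ^ Suc m < exp (- 1 / real (Suc m)) ^ Suc m"
    by (intro power_strict_mono) auto
  also have "\<dots> = exp (-1)"
    by (subst exp_of_nat_mult[symmetric]) simp
  finally show ?thesis .
qed

text \<open>As a function of \<open>s\<close>, the left side starts at 1, and passing from
  \<open>s\<close> to \<open>Suc s\<close> multiplies it by \<open>(m / (m + 1)) ^ (m + 1)\<close>
  with \<open>m = K + s\<close>, which is below \<open>exp (-1)\<close>.\<close>

lemma pochhammer_power_less_exp:
  assumes "0 < K" "0 < s"
  shows "pochhammer (real K) s * real K ^ K / real (K + s) ^ (K + s) < exp (- real s)"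
proof -
  define R where "R s = pochhammer (real K) s * real K ^ K / real (K + s) ^ (K + s)" for s
  have R_Suc: "R (Suc s) = R s * (real (K + s) / real (Suc (K + s))) ^ Suc (K + s)" for s
  proof -
    define y where "y = real (K + s)"
    have "y ^ Suc (K + s) / y ^ (K + s) = y" using assms(1) by (simp add: y_def)
    then show ?thesis
      by (simp add: R_def pochhammer_Suc power_divide y_def del: power_Suc of_nat_Suc of_nat_add)
         (simp add: mult_ac)
  qed
  have R_pos: "0 < R s" for s
    using assms(1) by (simp add: R_def pochhammer_pos)
  have step: "R (Suc s) < R s * exp (-1)" for s
    unfolding R_Suc using assms(1) R_pos[of s]
    by (intro mult_strict_left_mono one_minus_inverse_power_less_exp) auto
  have exp_Suc: "exp (- real (Suc s)) = exp (- real s) * exp (-1)" for s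
    by (simp add: exp_add[symmetric])
  have "R s \<le> exp (- real s)" for s
  proof (induction s)
    case 0
    then show ?case using assms(1) by (simp add: R_def)
  next
    case (Suc s)
    have "R s * exp (-1) \<le> exp (- real s) * exp (-1)"
      using Suc by (intro mult_right_mono) auto
    with step[of s] show ?case unfolding exp_Suc by linarith
  qed
  \<comment> \<open>At \<open>s = 0\<close> equality holds, so strictness comes from the last
    factor.\<close>
  moreover obtain t where "s = Suc t" using assms(2) by (cases s) auto
  ultimately have "R s < exp (- real t) * exp (-1)"
    using step[of t] by (metis exp_ge_zero less_le_trans mult_right_mono)
  then show ?thesis
    unfolding R_def[symmetric] \<open>s = Suc t\<close> exp_Suc .
qed

text \<open>The bound is uniform in \<open>K\<close>, hence applies at the switch index of every
  \<open>p\<close>. For \<open>K = 0\<close> the gap is 0.\<close>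

lemma neg_binomial_gap_less:
  assumes "0 < p" "p < 1" "0 < s"
  shows "neg_binomial_gap s p K < real s ^ s * exp (- real s) / fact s"
proof (cases "K = 0")
  case True
  then show ?thesis using assms by (simp add: neg_binomial_gap_def binomial_eq_0)
next
  case False
  then have K: "0 < K" by simp
  have "neg_binomial_gap s p K = pochhammer (real K) s / fact s * (p ^ s * (1 - p) ^ K)"
    using binomial_pochhammer[OF K, of s] by (simp add: neg_binomial_gap_def)
  also have "\<dots> \<le> pochhammer (real K) s / fact s *
      ((real s / real (K + s)) ^ s * (real K / real (K + s)) ^ K)"
    using assms K by (intro mult_left_mono power_mult_power_le_max) (auto simp: pochhammer_nonneg)
  also have "\<dots> = real s ^ s / fact s * (pochhammer (real K) s * real K ^ K / real (K + s) ^ (K + s))"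
    by (simp add: power_divide power_add mult_ac)
  also have "\<dots> < real s ^ s / fact s * exp (- real s)"
    using assms K by (intro mult_strict_left_mono pochhammer_power_less_exp) auto
  finally show ?thesis by simp
qed

section \<open>The limit\<close>

lemma switch_index_bounds:
  assumes "0 < p" "p \<le> 1"
  shows "real s / p - real s \<le> real (switch_index s p)"
    and "real (switch_index s p) \<le> real s / p - real s + 1"
proof -
  \<comment> \<open>This makes the natural-number subtraction in \<open>switch_index\<close>
    exact.\<close>
  have "real s \<le> real s / p" using assms by (simp add: field_simps mult_left_le_one_le)
  then have "int s \<le> \<lceil>real s / p\<rceil>" by linarith
  then have "real (switch_index s p) = real_of_int \<lceil>real s / p\<rceil> - real s"
    unfolding switch_index_def by (simp add: of_nat_diff nat_le_iff le_nat_iff)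
  then show "real s / p - real s \<le> real (switch_index s p)"
    and "real (switch_index s p) \<le> real s / p - real s + 1"
    by linarith+
qed

text \<open>Rounding up changes the index by at most 1, an error that vanishes after multiplication
  by \<open>p\<close>.\<close>

lemma tendsto_switch_index_mult:
  "((\<lambda>p. real (switch_index s p) * p) \<longlongrightarrow> real s) (at_right 0)"
proof (rule tendsto_sandwich)
  have ev: "\<forall>\<^sub>F p in at_right (0::real). 0 < p \<and> p \<le> 1"
    using eventually_at_right_real[of 0 "1::real"] by (auto elim!: eventually_mono)
  show "\<forall>\<^sub>F p in at_right 0. real s - real s * p \<le> real (switch_index s p) * p"
    using ev
  proof eventually_elim
    case (elim p)
    then have "(real s / p - real s) * p \<le> real (switch_index s p) * p"
      by (intro mult_right_mono switch_index_bounds) auto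
    then show ?case using elim by (simp add: algebra_simps)
  qed
  show "\<forall>\<^sub>F p in at_right 0. real (switch_index s p) * p \<le> real s - real s * p + p"
    using ev
  proof eventually_elim
    case (elim p)
    then have "real (switch_index s p) * p \<le> (real s / p - real s + 1) * p"
      by (intro mult_right_mono switch_index_bounds) auto
    then show ?case using elim by (simp add: algebra_simps)
  qed
  show "((\<lambda>p. real s - real s * p) \<longlongrightarrow> real s) (at_right 0)"
    by (auto intro!: tendsto_eq_intros)
  show "((\<lambda>p. real s - real s * p + p) \<longlongrightarrow> real s) (at_right 0)"
    by (auto intro!: tendsto_eq_intros)
qed

lemma tendsto_neg_binomial_gap:
  assumes "0 < s"
  shows "((\<lambda>p. neg_binomial_gap s p (switch_index s p)) \<longlongrightarrow>
    real s ^ s * exp (- real s) / fact s) (at_right 0)"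
proof -
  let ?K = "switch_index s"
  have lnl: "((\<lambda>p::real. ln (1 - p) / p) \<longlongrightarrow> -1) (at_right 0)"
    by real_asymp
  \<comment> \<open>The factor \<open>p ^ s\<close> is spread over the \<open>s\<close> factors of
    the Pochhammer product, each tending to \<open>s\<close>; \<open>(1 - p) ^ ?K p\<close> is
    written as an exponential whose exponent tends to \<open>- s\<close>.\<close>
  have "((\<lambda>p. (\<Prod>i<s. real (?K p) * p + real i * p) * exp (real (?K p) * p * (ln (1 - p) / p)) / fact s)
      \<longlongrightarrow> (\<Prod>i<s. real s + real i * 0) * exp (real s * (-1)) / fact s) (at_right 0)"
    by (intro tendsto_intros tendsto_switch_index_mult lnl) auto
  then have "((\<lambda>p. (\<Prod>i<s. real (?K p) * p + real i * p) * exp (real (?K p) * p * (ln (1 - p) / p)) / fact s)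
      \<longlongrightarrow> real s ^ s * exp (- real s) / fact s) (at_right 0)"
    by simp
  moreover have "\<forall>\<^sub>F p in at_right 0.
      (\<Prod>i<s. real (?K p) * p + real i * p) * exp (real (?K p) * p * (ln (1 - p) / p)) / fact s =
      neg_binomial_gap s p (?K p)"
    using eventually_at_right_real[of 0 "1::real", simplified]
  proof eventually_elim
    case (elim p)
    then have p: "0 < p" "p < 1" by auto
    \<comment> \<open>Strictness makes the switch index positive, as
      \<open>binomial_pochhammer\<close> requires.\<close>
    have "real s < real s / p" using p assms by (simp add: field_simps)
    then have K: "0 < ?K p" using p by (simp add: less_switch_index_iff)
    have "(\<Prod>i<s. real (?K p) * p + real i * p) = pochhammer (real (?K p)) s * p ^ s"
      by (simp add: pochhammer_prod distrib_right[symmetric] prod.distrib atLeast0LessThan)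
    moreover have "exp (real (?K p) * p * (ln (1 - p) / p)) = (1 - p) ^ ?K p"
      using p by (simp add: exp_of_nat_mult)
    ultimately show ?case
      using binomial_pochhammer[OF K, of s] by (simp add: neg_binomial_gap_def)
  qed
  ultimately show ?thesis
    by (rule Lim_transform_eventually)
qed

theorem theorem1:
  fixes a b :: real and r :: nat
  assumes "a \<ge> 0" and "b \<ge> 0" and "(a, b) \<noteq> (0, 0)" and "r \<ge> 2"
  shows "((\<lambda>p. risk (lin_lin_loss a b) (ibs_estimator r) r p) \<longlongrightarrow>
            (a + b) * (real r - 1) ^ (r - 2) * exp (- real r + 1) / fact (r - 2)) (at_right 0)
       \<and> (\<forall>p\<in>{0<..<1}. risk (lin_lin_loss a b) (ibs_estimator r) r p <
            (a + b) * (real r - 1) ^ (r - 2) * exp (- real r + 1) / fact (r - 2))"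
proof -
  define s where "s = r - 1"
  have s: "0 < s" "r = Suc s" using assms(4) by (auto simp: s_def)
  let ?c = "real s ^ s * exp (- real s) / fact s"
  \<comment> \<open>Cancelling one factor \<open>s\<close> turns the bound into the stated form with
    \<open>r - 2 = s - 1\<close>.\<close>
  have "real s ^ s / fact s = real s ^ (s - 1) / fact (s - 1)"
  proof (cases s)
    case (Suc t)
    show ?thesis
      unfolding Suc power_Suc fact_Suc diff_Suc_1 of_nat_mult
      by (rule mult_divide_mult_cancel_left) simp
  qed (use s(1) in simp)
  then have "(a + b) * ?c = (a + b) * exp (- real s) * (real s ^ (s - 1) / fact (s - 1))"
    by (metis mult.assoc mult.commute times_divide_eq_right)
  then have c: "(a + b) * (real r - 1) ^ (r - 2) * exp (- real r + 1) / fact (r - 2) = (a + b) * ?c"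
    by (simp add: s(2))
  have ab: "0 < a + b" using assms by auto
  have risk: "risk (lin_lin_loss a b) (ibs_estimator r) r p =
      (a + b) * neg_binomial_gap s p (switch_index s p)" if "p \<in> {0<..<1}" for p
    using that s by (simp add: risk_lin_lin_loss_ibs)
  have "((\<lambda>p. (a + b) * neg_binomial_gap s p (switch_index s p)) \<longlongrightarrow> (a + b) * ?c) (at_right 0)"
    by (intro tendsto_mult_left tendsto_neg_binomial_gap s)
  \<comment> \<open>The closed form is available for \<open>p\<close> in the open unit interval,
    which is enough for a right-hand limit at 0.\<close>
  moreover have "\<forall>\<^sub>F p in at_right 0. (a + b) * neg_binomial_gap s p (switch_index s p) =
      risk (lin_lin_loss a b) (ibs_estimator r) r p"
    using eventually_at_right_real[of 0 "1::real", simplified]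
    by eventually_elim (simp add: risk)
  ultimately have "((\<lambda>p. risk (lin_lin_loss a b) (ibs_estimator r) r p) \<longlongrightarrow> (a + b) * ?c) (at_right 0)"
    by (rule Lim_transform_eventually)
  moreover have "risk (lin_lin_loss a b) (ibs_estimator r) r p < (a + b) * ?c" if "p \<in> {0<..<1}" for p
    unfolding risk[OF that] using that ab s(1)
    by (intro mult_strict_left_mono neg_binomial_gap_less) auto
  ultimately show ?thesis
    unfolding c by blast
qed

end
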